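(* Let $\{G_i,\phi_{ij}\}$ be an inverse system, indexed by a directed poset $I$, of profinite groups and continuous homomorphisms, and let $G=\varprojlim_{i\in I}G_i$. If every $G_i$ is MP, then $G$ is MP. If every $G_i$ is SMP, then $G$ is SMP.
   Context: For a profinite group $G$ and $x\in G$, let $\langle x\rangle^G$ denote the normal closure of $x$ in $G$, understood topologically: the smallest closed normal subgroup of $G$ containing $x$. A profinite group $G$ has the Magnus Property (is MP) if whenever $x,y\in G$ satisfy $\langle x\rangle^G=\langle y\rangle^G$, then $x$ is conjugate in $G$ to $y$ or to $y^{-1}$. It has the Strong Magnus Property (is SMP) if whenever $x,y\in G$ satisfy $\langle x\rangle^G=\langle y\rangle^G$, then $x$ is conjugate in $G$ to $y$. The transition maps $\phi_{ij}:G_i\to G_j$ ($i\succcurlyeq j$) of the inverse system are not assumed to be surjective. *)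

theory Defs
  imports "HOL-Analysis.Analysis" "HOL-Algebra.Algebra"
begin

locale topological_group = group G
  for G :: "('a, 'b) monoid_scheme" (structure) and T :: "'a topology" +
  assumes topspace_eq: "topspace T = carrier G"
    and continuous_mult: "continuous_map (prod_topology T T) T (\<lambda>(x, y). x \<otimes> y)"
    and continuous_inv: "continuous_map T T (\<lambda>x. inv x)"

definition totally_disconnected_space :: "'a topology \<Rightarrow> bool" where
  "totally_disconnected_space T \<longleftrightarrow>
     (\<forall>x\<in>topspace T. connected_component_of_set T x = {x})"

locale profinite_group = topological_group G T
  for G :: "('a, 'b) monoid_scheme" (structure) and T :: "'a topology" +
  assumes compact: "compact_space T"
    and Hausdorff: "Hausdorff_space T"
    and totally_disconnected: "totally_disconnected_space T"

definition closed_normal_closure ::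
  "('a, 'b) monoid_scheme \<Rightarrow> 'a topology \<Rightarrow> 'a \<Rightarrow> 'a set" where
  "closed_normal_closure G T x = \<Inter>{N. N \<lhd> G \<and> closedin T N \<and> x \<in> N}"

lemma (in topological_group) closed_normal_closure:
  assumes "x \<in> carrier G"
  shows "closed_normal_closure G T x \<lhd> G"
    and "closedin T (closed_normal_closure G T x)"
    and "x \<in> closed_normal_closure G T x"
    and "\<And>N. \<lbrakk>N \<lhd> G; closedin T N; x \<in> N\<rbrakk> \<Longrightarrow> closed_normal_closure G T x \<subseteq> N"
proof -
  let ?F = "{N. N \<lhd> G \<and> closedin T N \<and> x \<in> N}"
  have "carrier G \<lhd> G"
    by (simp add: normal_inv_iff subgroup_self)
  then have ne: "carrier G \<in> ?F"
    using assms topspace_eq by (metis (mono_tags, lifting) closedin_topspace mem_Collect_eq)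
  then show "closedin T (closed_normal_closure G T x)"
    unfolding closed_normal_closure_def by (intro closedin_Inter) auto
  have "subgroup (\<Inter>?F) G"
    using ne by (intro subgroups_Inter) (auto simp: normal_inv_iff)
  then show "closed_normal_closure G T x \<lhd> G"
    unfolding closed_normal_closure_def by (auto simp: normal_inv_iff)
  show "x \<in> closed_normal_closure G T x"
    by (simp add: closed_normal_closure_def)
  show "closed_normal_closure G T x \<subseteq> N" if "N \<lhd> G" "closedin T N" "x \<in> N" for N
    using that by (auto simp: closed_normal_closure_def)
qed

definition conjugate_in :: "('a, 'b) monoid_scheme \<Rightarrow> 'a \<Rightarrow> 'a \<Rightarrow> bool" where
  "conjugate_in G x y \<longleftrightarrow> (\<exists>g\<in>carrier G. y = g \<otimes>\<^bsub>G\<^esub> x \<otimes>\<^bsub>G\<^esub> inv\<^bsub>G\<^esub> g)"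

text \<open>The Magnus properties are notions for profinite groups only, so profiniteness is part
  of the predicates.\<close>

definition magnus_property :: "('a, 'b) monoid_scheme \<Rightarrow> 'a topology \<Rightarrow> bool" where
  "magnus_property G T \<longleftrightarrow> profinite_group G T \<and>
     (\<forall>x\<in>carrier G. \<forall>y\<in>carrier G.
        closed_normal_closure G T x = closed_normal_closure G T y \<longrightarrow>
        conjugate_in G x y \<or> conjugate_in G x (inv\<^bsub>G\<^esub> y))"

definition strong_magnus_property :: "('a, 'b) monoid_scheme \<Rightarrow> 'a topology \<Rightarrow> bool" where
  "strong_magnus_property G T \<longleftrightarrow> profinite_group G T \<and>
     (\<forall>x\<in>carrier G. \<forall>y\<in>carrier G.
        closed_normal_closure G T x = closed_normal_closure G T y \<longrightarrow>
        conjugate_in G x y)"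

text \<open>A pair \<open>(j, i) \<in> r\<close> means \<open>j \<preceq> i\<close>; the transition map \<open>\<phi> i j\<close> then goes from
  \<open>G i\<close> to \<open>G j\<close>. Since \<open>\<phi> i j\<close> is a function on the whole type, the functoriality
  equations are imposed on the carriers only.\<close>

locale profinite_inverse_system =
  fixes I :: "'i set" and r :: "'i rel"
    and G :: "'i \<Rightarrow> ('a, 'b) monoid_scheme" and T :: "'i \<Rightarrow> 'a topology"
    and \<phi> :: "'i \<Rightarrow> 'i \<Rightarrow> 'a \<Rightarrow> 'a"
  assumes poset: "partial_order_on I r"
    and directed: "\<And>i j. \<lbrakk>i \<in> I; j \<in> I\<rbrakk> \<Longrightarrow> \<exists>k\<in>I. (i, k) \<in> r \<and> (j, k) \<in> r"
    and profinite: "\<And>i. i \<in> I \<Longrightarrow> profinite_group (G i) (T i)"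
    and transition_hom: "\<And>i j. (j, i) \<in> r \<Longrightarrow> \<phi> i j \<in> hom (G i) (G j)"
    and transition_continuous: "\<And>i j. (j, i) \<in> r \<Longrightarrow> continuous_map (T i) (T j) (\<phi> i j)"
    and transition_id: "\<And>i x. \<lbrakk>i \<in> I; x \<in> carrier (G i)\<rbrakk> \<Longrightarrow> \<phi> i i x = x"
    and transition_comp: "\<And>i j k x. \<lbrakk>(k, j) \<in> r; (j, i) \<in> r; x \<in> carrier (G i)\<rbrakk> \<Longrightarrow>
           \<phi> j k (\<phi> i j x) = \<phi> i k x"

text \<open>The inverse limit is the group of compatible families inside the direct product, with the
  subspace topology of the product topology.\<close>

definition inverse_limit_group ::
  "'i set \<Rightarrow> 'i rel \<Rightarrow> ('i \<Rightarrow> ('a, 'b) monoid_scheme) \<Rightarrow> ('i \<Rightarrow> 'i \<Rightarrow> 'a \<Rightarrow> 'a) \<Rightarrow>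
   ('i \<Rightarrow> 'a) monoid" where
  "inverse_limit_group I r G \<phi> =
     (product_group I G)
       \<lparr>carrier := {x \<in> carrier (product_group I G). \<forall>(j, i)\<in>r. \<phi> i j (x i) = x j}\<rparr>"

definition inverse_limit_topology ::
  "'i set \<Rightarrow> 'i rel \<Rightarrow> ('i \<Rightarrow> ('a, 'b) monoid_scheme) \<Rightarrow> ('i \<Rightarrow> 'a topology) \<Rightarrow>
   ('i \<Rightarrow> 'i \<Rightarrow> 'a \<Rightarrow> 'a) \<Rightarrow> ('i \<Rightarrow> 'a) topology" where
  "inverse_limit_topology I r G T \<phi> =
     subtopology (product_topology T I) (carrier (inverse_limit_group I r G \<phi>))"

end

theory Submission
  imports Defs
begin

text \<open>Projecting to each \<open>G i\<close> preserves equality of closed normal closures, so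
  \<open>x i\<close> is conjugate to \<open>y i\<close> or to its inverse. By directedness the sign can be chosen
  independently of \<open>i\<close>: if \<open>x i\<close> is not conjugate to \<open>y i\<close>, the same holds above \<open>i\<close>, and
  conjugacy to the inverse descends along the transition maps. The sets of conjugating
  elements are then nonempty, compact and mapped into each other by the transition maps, so by
  compactness they have a compatible family, which conjugates in the limit.\<close>

section \<open>Profinite groups\<close>

text \<open>A point lies in its own component, and any connected set through it lies in that
  component. The form with connected sets is the convenient one: such sets stay connected in the
  ambient space and under projections.\<close>

lemma totally_disconnected_space_iff:
  "totally_disconnected_space T \<longleftrightarrow>
     (\<forall>S. connectedin T S \<longrightarrow> (\<forall>a\<in>S. \<forall>b\<in>S. a = b))"
proof
  assume td: "totally_disconnected_space T"
  show "\<forall>S. connectedin T S \<longrightarrow> (\<forall>a\<in>S. \<forall>b\<in>S. a = b)"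
  proof (intro allI impI ballI)
    fix S a b assume S: "connectedin T S" "a \<in> S" "b \<in> S"
    have "a \<in> topspace T"
      using connectedin_subset_topspace[OF S(1)] S(2) by (rule subsetD)
    then have "connected_component_of_set T a = {a}"
      using td unfolding totally_disconnected_space_def by (rule bspec[rotated])
    then have "S \<subseteq> {a}"
      using connected_component_of_maximal[OF S(1,2)] by simp
    then show "a = b"
      using S(3) by blast
  qed
next
  assume *: "\<forall>S. connectedin T S \<longrightarrow> (\<forall>a\<in>S. \<forall>b\<in>S. a = b)"
  show "totally_disconnected_space T"
    unfolding totally_disconnected_space_def
  proof
    fix x assume "x \<in> topspace T"
    then have x: "x \<in> connected_component_of_set T x"
      by (simp add: connected_component_of_refl)
    have "y = x" if "y \<in> connected_component_of_set T x" for y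
      using *[rule_format, OF connectedin_connected_component_of that x] .
    with x show "connected_component_of_set T x = {x}"
      by (auto simp only: set_eq_iff singleton_iff)
  qed
qed

lemma totally_disconnected_space_subtopology:
  "totally_disconnected_space T \<Longrightarrow> totally_disconnected_space (subtopology T S)"
  by (auto simp: totally_disconnected_space_iff connectedin_subtopology)

text \<open>Each projection of a connected set is connected, hence has at most one point, and an
  extensional family is determined by its coordinates.\<close>

lemma totally_disconnected_space_product_topology:
  assumes "\<And>i. i \<in> I \<Longrightarrow> totally_disconnected_space (T i)"
  shows "totally_disconnected_space (product_topology T I)"
  unfolding totally_disconnected_space_iff
proof (intro allI impI ballI)
  fix S a b assume S: "connectedin (product_topology T I) S" "a \<in> S" "b \<in> S"
  then have sub: "S \<subseteq> (\<Pi>\<^sub>E i\<in>I. topspace (T i))"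
    using connectedin_subset_topspace[OF S(1)] by simp
  have eq: "a i = b i" if "i \<in> I" for i
  proof -
    have "connectedin (T i) ((\<lambda>x. x i) ` S)"
      using continuous_map_product_projection[OF that, of T] S(1)
      by (rule connectedin_continuous_map_image)
    moreover have "a i \<in> (\<lambda>x. x i) ` S" "b i \<in> (\<lambda>x. x i) ` S"
      using S(2,3) by auto
    ultimately show ?thesis
      using assms[OF that, unfolded totally_disconnected_space_iff] by simp
  qed
  show "a = b"
    by (rule PiE_ext[of a I "\<lambda>i. topspace (T i)" b]) (use S(2,3) sub eq in auto)
qed

section \<open>Products and closed subgroups of topological groups\<close>

lemma topological_group_product_group:
  assumes "\<And>i. i \<in> I \<Longrightarrow> topological_group (G i) (T i)"
  shows "topological_group (product_group I G) (product_topology T I)"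
proof -
  have gr: "group (G i)" if "i \<in> I" for i
    using assms[OF that] by (simp add: topological_group_def)
  have top: "topspace (T i) = carrier (G i)" if "i \<in> I" for i
    using assms[OF that] by (simp add: topological_group.topspace_eq)
  have eq: "(\<Pi>\<^sub>E i\<in>I. topspace (T i)) = (\<Pi>\<^sub>E i\<in>I. carrier (G i))"
    by (rule PiE_cong) (rule top)
  interpret P: group "product_group I G"
    using gr by simp
  show ?thesis
  proof
    show "topspace (product_topology T I) = carrier (product_group I G)"
      by (simp add: eq)
    let ?P = "product_topology T I"
    have "continuous_map (prod_topology ?P ?P) (T i) (\<lambda>p. fst p i \<otimes>\<^bsub>G i\<^esub> snd p i)"
      if i: "i \<in> I" for i
    proof -
      have "continuous_map (prod_topology ?P ?P) (prod_topology (T i) (T i))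
              (\<lambda>p. (fst p i, snd p i))"
        using continuous_map_compose[OF continuous_map_fst continuous_map_product_projection[OF i, of T]]
          continuous_map_compose[OF continuous_map_snd continuous_map_product_projection[OF i, of T]]
        by (intro continuous_map_pairedI) (simp_all add: o_def)
      from continuous_map_compose[OF this topological_group.continuous_mult[OF assms[OF i]]]
      show ?thesis by (simp only: o_def case_prod_unfold fst_conv snd_conv)
    qed
    then have "continuous_map (prod_topology ?P ?P) ?P
        (\<lambda>p. \<lambda>i\<in>I. fst p i \<otimes>\<^bsub>G i\<^esub> snd p i)"
      by (intro continuous_map_componentwise[THEN iffD2]) auto
    then show "continuous_map (prod_topology ?P ?P) ?P (\<lambda>(x, y). x \<otimes>\<^bsub>product_group I G\<^esub> y)"
      by (simp only: case_prod_unfold mult_product_group)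
    have "continuous_map ?P (T i) (\<lambda>x. inv\<^bsub>G i\<^esub> x i)" if i: "i \<in> I" for i
      using continuous_map_compose[OF continuous_map_product_projection[OF i, of T]
          topological_group.continuous_inv[OF assms[OF i]]] by (simp add: o_def)
    then have "continuous_map ?P ?P (\<lambda>x. \<lambda>i\<in>I. inv\<^bsub>G i\<^esub> x i)"
      by (intro continuous_map_componentwise[THEN iffD2]) auto
    then show "continuous_map ?P ?P (\<lambda>x. inv\<^bsub>product_group I G\<^esub> x)"
      \<comment> \<open>Inversion in the product group is identified with coordinatewise inversion
        on the carrier; this suffices because the carrier is the whole space.\<close>
      by (rule continuous_map_eq) (simp add: eq gr)
  qed
qed

lemma (in topological_group) topological_group_subgroup:
  assumes "subgroup H G"
  shows "topological_group (G\<lparr>carrier := H\<rparr>) (subtopology T H)"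
proof -
  interpret H: group "G\<lparr>carrier := H\<rparr>"
    by (rule subgroup_imp_group[OF assms])
  have sub: "H \<subseteq> carrier G"
    using assms by (rule subgroup.subset)
  show ?thesis
  proof
    show "topspace (subtopology T H) = carrier (G\<lparr>carrier := H\<rparr>)"
      using sub topspace_eq by auto
    have "continuous_map (prod_topology (subtopology T H) (subtopology T H)) T (\<lambda>(x, y). x \<otimes> y)"
      \<comment> \<open>The product of two subspaces is a subspace of the product, so multiplication
        on \<open>H\<close> is a restriction of a continuous map.\<close>
      unfolding subtopology_Times[symmetric]
      by (rule continuous_map_from_subtopology[OF continuous_mult])
    then show "continuous_map (prod_topology (subtopology T H) (subtopology T H)) (subtopology T H)
        (\<lambda>(x, y). x \<otimes>\<^bsub>G\<lparr>carrier := H\<rparr>\<^esub> y)"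
      using subgroup.m_closed[OF assms] by (auto simp: continuous_map_in_subtopology)
    have "continuous_map (subtopology T H) (subtopology T H) (\<lambda>x. inv x)"
      using continuous_map_from_subtopology[OF continuous_inv] subgroup.m_inv_closed[OF assms]
      by (auto simp: continuous_map_in_subtopology)
    then show "continuous_map (subtopology T H) (subtopology T H) (\<lambda>x. inv\<^bsub>G\<lparr>carrier := H\<rparr>\<^esub> x)"
      by (rule continuous_map_eq) (simp add: assms)
  qed
qed

lemma profinite_group_product_group:
  assumes "\<And>i. i \<in> I \<Longrightarrow> profinite_group (G i) (T i)"
  shows "profinite_group (product_group I G) (product_topology T I)"
proof -
  interpret topological_group "product_group I G" "product_topology T I"
    by (rule topological_group_product_group) (use assms profinite_group_def in blast)
  show ?thesis
    using assms
    by unfold_locales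
      (blast intro: compact_space_product_topology[THEN iffD2] profinite_group.compact
         Hausdorff_space_product_topology[THEN iffD2] profinite_group.Hausdorff
         totally_disconnected_space_product_topology profinite_group.totally_disconnected)+
qed

lemma (in profinite_group) profinite_group_subgroup:
  assumes "subgroup H G" "closedin T H"
  shows "profinite_group (G\<lparr>carrier := H\<rparr>) (subtopology T H)"
proof -
  interpret H: topological_group "G\<lparr>carrier := H\<rparr>" "subtopology T H"
    by (rule topological_group_subgroup[OF assms(1)])
  show ?thesis
    by unfold_locales
      (intro compact_space_subtopology closedin_compact_space compact assms
        Hausdorff_space_subtopology Hausdorff totally_disconnected
        totally_disconnected_space_subtopology)+
qed

text \<open>The set is the equaliser of a constant map and the continuous map sending
  \<open>g\<close> to the conjugate of \<open>x\<close> by \<open>g\<close>, with values in a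
  Hausdorff space.\<close>

lemma (in topological_group) closedin_conjugators:
  assumes "Hausdorff_space T" "x \<in> carrier G" "z \<in> carrier G"
  shows "closedin T {g \<in> carrier G. z = g \<otimes> x \<otimes> inv g}"
proof -
  have const: "continuous_map T T (\<lambda>g. a)" if "a \<in> carrier G" for a
    using that topspace_eq by simp
  have mult: "continuous_map T T (\<lambda>g. f g \<otimes> h g)"
    if "continuous_map T T f" "continuous_map T T h" for f h
    using continuous_map_compose[OF continuous_map_pairedI[OF that] continuous_mult]
    by (simp add: o_def)
  have "continuous_map T T (\<lambda>g. g \<otimes> x \<otimes> inv g)"
    by (intro mult const assms continuous_inv continuous_map_id[unfolded id_def])
  from closedin_continuous_maps_eq[OF assms(1) const[OF assms(3)] this]
  show ?thesis by (simp add: topspace_eq)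
qed

section \<open>Homomorphisms\<close>

lemma (in group_hom) normal_vimage:
  assumes "N \<lhd> H"
  shows "{x \<in> carrier G. h x \<in> N} \<lhd> G"
proof -
  interpret N: normal N H by fact
  have "subgroup {x \<in> carrier G. h x \<in> N} G"
    by (rule G.subgroupI) (auto intro: exI[of _ "\<one>"])
  then show ?thesis
    using N.inv_op_closed2 by (auto simp: G.normal_inv_iff)
qed

text \<open>Closed normal subgroups of the target are pulled back: the preimage of one containing
  \<open>h x\<close> is closed, normal and contains \<open>x\<close>, hence contains
  \<open>y\<close>. Preimages of normal subgroups are normal under any homomorphism, while images
  may fail to be.\<close>

lemma (in group_hom) closed_normal_closure_image:
  assumes "continuous_map T U h" "topspace T = carrier G" "x \<in> carrier G"
    and "y \<in> closed_normal_closure G T x"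
  shows "h y \<in> closed_normal_closure H U (h x)"
  unfolding closed_normal_closure_def
proof clarify
  fix N assume N: "N \<lhd> H" "closedin U N" "h x \<in> N"
  have "closedin T {x \<in> carrier G. h x \<in> N}"
    using closedin_continuous_map_preimage[OF assms(1) N(2)] assms(2) by simp
  then show "h y \<in> N"
    using assms(3,4) N(3) normal_vimage[OF N(1)] by (auto simp: closed_normal_closure_def)
qed

lemma (in group_hom) closed_normal_closure_image_eq:
  assumes "topological_group G T" "topological_group H U" "continuous_map T U h"
    and "x \<in> carrier G" "y \<in> carrier G"
    and eq: "closed_normal_closure G T x = closed_normal_closure G T y"
  shows "closed_normal_closure H U (h x) = closed_normal_closure H U (h y)"
proof -
  \<comment> \<open>Stated for an arbitrary pair, so that exchanging the two elements gives the
    reverse inclusion. By minimality it is enough that \<open>h a\<close> lies in the closure of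
    \<open>h b\<close>.\<close>
  have "closed_normal_closure H U (h a) \<subseteq> closed_normal_closure H U (h b)"
    if "a \<in> carrier G" "b \<in> carrier G"
      "closed_normal_closure G T a = closed_normal_closure G T b" for a b
  proof -
    have "a \<in> closed_normal_closure G T b"
      using topological_group.closed_normal_closure(3)[OF assms(1) that(1)] that(3) by simp
    then have "h a \<in> closed_normal_closure H U (h b)"
      using closed_normal_closure_image assms(1,3) that(2) topological_group.topspace_eq by blast
    then show ?thesis
      using topological_group.closed_normal_closure[OF assms(2)] that by simp
  qed
  then show ?thesis
    using assms(4,5) eq by (intro equalityI) simp_all
qed

lemma (in group_hom) conjugate_in_image:
  assumes "conjugate_in G x y" "x \<in> carrier G"
  shows "conjugate_in H (h x) (h y)"
  using assms unfolding conjugate_in_def by (auto intro!: bexI[of _ "h _"])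

section \<open>Inverse limits\<close>

text \<open>An inverse system of nonempty compact sets has a nonempty limit. By Tychonoff the
  product is compact, and the compatible families form the intersection of closed nonempty sets
  \<open>F k\<close> that shrink as \<open>k\<close> grows, so the finite intersection property
  applies.\<close>

lemma compatible_family_exists:
  fixes T :: "'i \<Rightarrow> 'a topology"
  assumes preorder: "preorder_on I r"
    and directed: "\<And>i j. \<lbrakk>i \<in> I; j \<in> I\<rbrakk> \<Longrightarrow> \<exists>k\<in>I. (i, k) \<in> r \<and> (j, k) \<in> r"
    and compact: "\<And>i. i \<in> I \<Longrightarrow> compact_space (T i)"
    and Hausdorff: "\<And>i. i \<in> I \<Longrightarrow> Hausdorff_space (T i)"
    and cont: "\<And>i j. (j, i) \<in> r \<Longrightarrow> continuous_map (T i) (T j) (\<phi> i j)"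
    and comp: "\<And>i j k x. \<lbrakk>(k, j) \<in> r; (j, i) \<in> r; x \<in> topspace (T i)\<rbrakk> \<Longrightarrow>
           \<phi> j k (\<phi> i j x) = \<phi> i k x"
    and id: "\<And>i x. \<lbrakk>i \<in> I; x \<in> topspace (T i)\<rbrakk> \<Longrightarrow> \<phi> i i x = x"
    and closed: "\<And>i. i \<in> I \<Longrightarrow> closedin (T i) (C i)"
    and nonempty: "\<And>i. i \<in> I \<Longrightarrow> C i \<noteq> {}"
    and image: "\<And>i j. (j, i) \<in> r \<Longrightarrow> \<phi> i j ` C i \<subseteq> C j"
  shows "\<exists>g\<in>(\<Pi>\<^sub>E i\<in>I. C i). \<forall>(j, i)\<in>r. \<phi> i j (g i) = g j"
\<comment> \<open>Over the empty index set the intersection of all \<open>F k\<close> would be the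
  whole type and give no extensional family; there \<open>r\<close> is empty and the one extensional
  function serves.\<close>
proof (cases "I = {}")
  case True
  then show ?thesis using preorder by (auto simp: preorder_on_def)
next
  case False
  have rI: "i \<in> I \<and> j \<in> I" if "(j, i) \<in> r" for i j
    using preorder that by (auto simp: preorder_on_def)
  have refl: "(i, i) \<in> r" if "i \<in> I" for i
    using preorder that by (auto simp: preorder_on_def refl_on_def)
  have trans: "(i, k) \<in> r" if "(i, j) \<in> r" "(j, k) \<in> r" for i j k
    using preorder that by (auto simp: preorder_on_def dest: transD)
  have Csub: "C i \<subseteq> topspace (T i)" if "i \<in> I" for i
    using closed[OF that] by (rule closedin_subset)
  let ?P = "product_topology T I"
  \<comment> \<open>\<open>F k\<close> imposes only the equations starting at the index
    \<open>k\<close>: they express the coordinates below \<open>k\<close> through the one at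
    \<open>k\<close>. This makes it easy to find an element of a single \<open>F k\<close>.\<close>
  define F where "F k = {g \<in> topspace ?P. g k \<in> C k \<and> (\<forall>j. (j, k) \<in> r \<longrightarrow> \<phi> k j (g k) = g j)}" for k
  have F_closed: "closedin ?P (F k)" if k: "k \<in> I" for k
  proof -
    have "closedin ?P {g \<in> topspace ?P. \<phi> k j (g k) = g j}" if "(j, k) \<in> r" for j
    proof (rule closedin_continuous_maps_eq)
      show "Hausdorff_space (T j)" "continuous_map ?P (T j) (\<lambda>g. g j)"
        using Hausdorff rI that by auto
      show "continuous_map ?P (T j) (\<lambda>g. \<phi> k j (g k))"
        using continuous_map_compose[OF continuous_map_product_projection[OF k, of T] cont[OF that]]
        by (simp add: o_def)
    qed
    moreover have "closedin ?P {g \<in> topspace ?P. g k \<in> C k}"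
      by (rule closedin_continuous_map_preimage[OF continuous_map_product_projection])
        (use k closed in auto)
    \<comment> \<open>Reflexivity puts \<open>k\<close> itself among the indices \<open>j\<close>,
      so the intersection over \<open>j\<close> is taken over a nonempty family.\<close>
    ultimately have "closedin ?P ({g \<in> topspace ?P. g k \<in> C k} \<inter>
        (\<Inter>j\<in>{j. (j, k) \<in> r}. {g \<in> topspace ?P. \<phi> k j (g k) = g j}))"
      using refl[OF k] by (intro closedin_Int closedin_INT) auto
    also have "{g \<in> topspace ?P. g k \<in> C k} \<inter>
        (\<Inter>j\<in>{j. (j, k) \<in> r}. {g \<in> topspace ?P. \<phi> k j (g k) = g j}) = F k"
      using refl[OF k] by (auto simp: F_def)
    finally show ?thesis .
  qed
  have F_ne: "F k \<noteq> {}" if k: "k \<in> I" for k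
  proof -
    obtain c where c: "c \<in> C k" using nonempty[OF k] by blast
    \<comment> \<open>A chosen \<open>c\<close> is pushed down to every index below
      \<open>k\<close>; at the other indices, which \<open>F k\<close> does not constrain, any
      element of \<open>C j\<close> will do.\<close>
    let ?g = "\<lambda>j\<in>I. if (j, k) \<in> r then \<phi> k j c else SOME d. d \<in> C j"
    have gC: "?g j \<in> C j" if "j \<in> I" for j
      using that c image nonempty[OF that] by (auto simp: some_in_eq)
    have "?g k = c"
      using k refl[OF k] id[OF k] c Csub[OF k] by auto
    then have "?g \<in> F k"
      using gC Csub c k rI by (auto simp: F_def)
    then show ?thesis by blast
  qed
  \<comment> \<open>For \<open>k\<close> below \<open>l\<close>, the coordinate at \<open>k\<close>
    is the image of the one at \<open>l\<close>. So it lies in \<open>C k\<close>, and functoriality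
    turns the equations from \<open>l\<close> into those from \<open>k\<close>.\<close>
  have F_anti: "F l \<subseteq> F k" if kl: "(k, l) \<in> r" for k l
  proof
    fix g assume g: "g \<in> F l"
    then have gl: "g l \<in> C l" "g l \<in> topspace (T l)"
      using Csub rI[OF kl] by (auto simp: F_def)
    have gk: "\<phi> l k (g l) = g k"
      using g kl by (auto simp: F_def)
    have "g k \<in> C k"
      using image[OF kl] gl(1) gk by auto
    moreover have "\<phi> k j (g k) = g j" if "(j, k) \<in> r" for j
      using g gk comp[OF that kl gl(2)] trans[OF that kl] by (auto simp: F_def)
    ultimately show "g \<in> F k"
      using g by (auto simp: F_def)
  qed
  have bound: "\<exists>k\<in>I. \<forall>j\<in>J. (j, k) \<in> r" if "finite J" "J \<subseteq> I" for J
    using that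
  proof (induction J rule: finite_induct)
    case empty
    then show ?case using False by auto
  next
    case (insert j J)
    then obtain k where "k \<in> I" "\<forall>j\<in>J. (j, k) \<in> r" by auto
    moreover obtain l where "l \<in> I" "(j, l) \<in> r" "(k, l) \<in> r"
      using directed insert.prems \<open>k \<in> I\<close> by blast
    ultimately show ?case using trans by blast
  qed
  have "\<Inter>(F ` I) \<noteq> {}"
  proof -
    have "compact_space ?P"
      using compact by (simp add: compact_space_product_topology)
    moreover have "\<Inter>\<F> \<noteq> {}" if "finite \<F>" "\<F> \<subseteq> F ` I" for \<F>
    proof -
      obtain J where J: "finite J" "J \<subseteq> I" "\<F> = F ` J"
        using finite_subset_image[OF \<open>finite \<F>\<close> \<open>\<F> \<subseteq> F ` I\<close>] by blast
      obtain k where k: "k \<in> I" "\<forall>j\<in>J. (j, k) \<in> r"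
        using bound[OF J(1,2)] by blast
      \<comment> \<open>An upper bound \<open>k\<close> of the finitely many indices yields one
        nonempty set inside all of them.\<close>
      then have "F k \<subseteq> \<Inter>\<F>"
        using F_anti J(3) by blast
      then show ?thesis using F_ne[OF k(1)] by blast
    qed
    ultimately show ?thesis
      using F_closed unfolding compact_space_fip by blast
  qed
  then obtain g where "\<And>k. k \<in> I \<Longrightarrow> g \<in> F k" by blast
  \<comment> \<open>The equation for a pair \<open>(j, i)\<close> is read off from membership in
    \<open>F i\<close>; nonemptiness of \<open>I\<close> makes \<open>g\<close> extensional.\<close>
  then show ?thesis
    using False rI by (intro bexI[of _ g]) (auto simp: F_def PiE_iff)
qed

section \<open>The inverse limit as a profinite group\<close>

context profinite_inverse_system
begin

abbreviation "lim_group \<equiv> inverse_limit_group I r G \<phi>"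

abbreviation "lim_top \<equiv> inverse_limit_topology I r G T \<phi>"

lemma preorder: "preorder_on I r"
  using poset by (simp add: partial_order_on_def)

lemma index_mem: "(j, i) \<in> r \<Longrightarrow> i \<in> I \<and> j \<in> I"
  using preorder by (auto simp: preorder_on_def)

lemma group_factor: "i \<in> I \<Longrightarrow> group (G i)"
  using profinite by (simp add: profinite_group_def topological_group_def)

lemma topological_group_factor: "i \<in> I \<Longrightarrow> topological_group (G i) (T i)"
  using profinite by (simp add: profinite_group_def)

lemma topspace_factor: "i \<in> I \<Longrightarrow> topspace (T i) = carrier (G i)"
  by (rule topological_group.topspace_eq[OF topological_group_factor])

lemma group_hom_transition: "(j, i) \<in> r \<Longrightarrow> group_hom (G i) (G j) (\<phi> i j)"
  unfolding group_hom_def group_hom_axioms_def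
  by (intro conjI transition_hom group_factor) (simp_all add: index_mem[of j i])

lemma mem_carrier_limit_iff:
  "x \<in> carrier lim_group \<longleftrightarrow> x \<in> (\<Pi>\<^sub>E i\<in>I. carrier (G i)) \<and> (\<forall>(j, i)\<in>r. \<phi> i j (x i) = x j)"
  by (simp add: inverse_limit_group_def)

lemma mem_carrier_limitI:
  assumes "\<And>i. i \<in> I \<Longrightarrow> f i \<in> carrier (G i)"
    and "\<And>i j. \<lbrakk>(j, i) \<in> r; i \<in> I; j \<in> I\<rbrakk> \<Longrightarrow> \<phi> i j (f i) = f j"
  shows "(\<lambda>i\<in>I. f i) \<in> carrier lim_group"
  unfolding mem_carrier_limit_iff
proof (intro conjI)
  show "(\<lambda>i\<in>I. f i) \<in> (\<Pi>\<^sub>E i\<in>I. carrier (G i))"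
    using assms(1) by simp
  show "\<forall>(j, i)\<in>r. \<phi> i j ((\<lambda>i\<in>I. f i) i) = (\<lambda>i\<in>I. f i) j"
  proof clarify
    fix j i assume ji: "(j, i) \<in> r"
    then show "\<phi> i j ((\<lambda>i\<in>I. f i) i) = (\<lambda>i\<in>I. f i) j"
      using assms(2)[OF ji] index_mem[OF ji] by simp
  qed
qed

lemma transition_limit: "\<lbrakk>x \<in> carrier lim_group; (j, i) \<in> r\<rbrakk> \<Longrightarrow> \<phi> i j (x i) = x j"
  by (auto simp: mem_carrier_limit_iff)

lemma limit_component: "\<lbrakk>x \<in> carrier lim_group; i \<in> I\<rbrakk> \<Longrightarrow> x i \<in> carrier (G i)"
  by (auto simp: mem_carrier_limit_iff)

text \<open>Used folded: it lets the general facts about a subgroup, as the ambient group with its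
  carrier replaced, speak of the limit.\<close>

lemma limit_eq: "lim_group = (product_group I G)\<lparr>carrier := carrier lim_group\<rparr>"
  by (simp add: inverse_limit_group_def)

lemma mult_limit: "x \<otimes>\<^bsub>lim_group\<^esub> y = (\<lambda>i\<in>I. x i \<otimes>\<^bsub>G i\<^esub> y i)"
  by (simp add: inverse_limit_group_def)

lemma subgroup_limit: "subgroup (carrier lim_group) (product_group I G)"
proof
  show "carrier lim_group \<subseteq> carrier (product_group I G)"
    by (rule subsetI) (simp add: mem_carrier_limit_iff)
next
  fix x y assume x: "x \<in> carrier lim_group" and y: "y \<in> carrier lim_group"
  have "(\<lambda>i\<in>I. x i \<otimes>\<^bsub>G i\<^esub> y i) \<in> carrier lim_group"
  proof (rule mem_carrier_limitI)
    show "x i \<otimes>\<^bsub>G i\<^esub> y i \<in> carrier (G i)" if "i \<in> I" for i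
      using that group_factor limit_component x y by (simp add: group.is_monoid monoid.m_closed)
    show "\<phi> i j (x i \<otimes>\<^bsub>G i\<^esub> y i) = x j \<otimes>\<^bsub>G j\<^esub> y j" if "(j, i) \<in> r" "i \<in> I" for i j
      using hom_mult[OF transition_hom[OF that(1)]] limit_component[OF _ that(2)]
        transition_limit[OF _ that(1)] x y by simp
  qed
  then show "x \<otimes>\<^bsub>product_group I G\<^esub> y \<in> carrier lim_group"
    by simp
next
  have "(\<lambda>i\<in>I. \<one>\<^bsub>G i\<^esub>) \<in> carrier lim_group"
  proof (rule mem_carrier_limitI)
    show "\<one>\<^bsub>G i\<^esub> \<in> carrier (G i)" if "i \<in> I" for i
      using that group_factor by (simp add: group.is_monoid monoid.one_closed)
    show "\<phi> i j \<one>\<^bsub>G i\<^esub> = \<one>\<^bsub>G j\<^esub>" if "(j, i) \<in> r" for i j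
      by (rule group_hom.hom_one[OF group_hom_transition[OF that]])
  qed
  then show "\<one>\<^bsub>product_group I G\<^esub> \<in> carrier lim_group"
    by simp
next
  fix x assume x: "x \<in> carrier lim_group"
  have "(\<lambda>i\<in>I. inv\<^bsub>G i\<^esub> x i) \<in> carrier lim_group"
  proof (rule mem_carrier_limitI)
    show "inv\<^bsub>G i\<^esub> x i \<in> carrier (G i)" if "i \<in> I" for i
      using that group_factor limit_component x by (simp add: group.inv_closed)
    show "\<phi> i j (inv\<^bsub>G i\<^esub> x i) = inv\<^bsub>G j\<^esub> x j" if "(j, i) \<in> r" "i \<in> I" for i j
      using group_hom.hom_inv[OF group_hom_transition[OF that(1)] limit_component[OF x that(2)]]
        transition_limit[OF x that(1)] by simp
  qed
  moreover have "inv\<^bsub>product_group I G\<^esub> x = (\<lambda>i\<in>I. inv\<^bsub>G i\<^esub> x i)"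
    using x group_factor by (intro inv_product_group) (auto simp: mem_carrier_limit_iff)
  ultimately show "inv\<^bsub>product_group I G\<^esub> x \<in> carrier lim_group"
    by simp
qed

lemma group_limit: "group lim_group"
proof -
  interpret P: group "product_group I G"
    using group_factor by simp
  show ?thesis
    by (subst limit_eq) (rule P.subgroup_imp_group[OF subgroup_limit])
qed

lemma inv_limit: "x \<in> carrier lim_group \<Longrightarrow> inv\<^bsub>lim_group\<^esub> x = (\<lambda>i\<in>I. inv\<^bsub>G i\<^esub> x i)"
proof -
  interpret P: group "product_group I G"
    using group_factor by simp
  assume x: "x \<in> carrier lim_group"
  then have "inv\<^bsub>lim_group\<^esub> x = inv\<^bsub>product_group I G\<^esub> x"
    using P.m_inv_consistent[OF subgroup_limit x, folded limit_eq] by simp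
  then show ?thesis
    using x group_factor by (simp add: mem_carrier_limit_iff)
qed

text \<open>Each compatibility equation cuts out the equaliser of two continuous maps into a
  Hausdorff factor, and the limit is the intersection of these.\<close>

lemma closedin_limit: "closedin (product_topology T I) (carrier lim_group)"
proof -
  let ?P = "product_topology T I"
  have "closedin ?P {x \<in> topspace ?P. \<phi> i j (x i) = x j}" if ji: "(j, i) \<in> r" for i j
  proof (rule closedin_continuous_maps_eq)
    show "Hausdorff_space (T j)"
      using index_mem[OF ji] profinite[THEN profinite_group.Hausdorff] by blast
    show "continuous_map ?P (T j) (\<lambda>g. g j)"
      using index_mem[OF ji] by (simp add: continuous_map_product_projection)
    show "continuous_map ?P (T j) (\<lambda>g. \<phi> i j (g i))"
      using continuous_map_compose[OF continuous_map_product_projection[of i I T]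
          transition_continuous[OF ji]] index_mem[OF ji] by (simp add: o_def)
  qed
  \<comment> \<open>Inserting the whole product keeps the intersection inside it even when
    \<open>r\<close> is empty.\<close>
  then have "closedin ?P (\<Inter>(insert (topspace ?P)
      ((\<lambda>(j, i). {x \<in> topspace ?P. \<phi> i j (x i) = x j}) ` r)))"
    by (intro closedin_Inter) (auto simp del: topspace_product_topology)
  also have "\<Inter>(insert (topspace ?P)
      ((\<lambda>(j, i). {x \<in> topspace ?P. \<phi> i j (x i) = x j}) ` r)) = carrier lim_group"
  proof -
    have "topspace ?P = (\<Pi>\<^sub>E i\<in>I. carrier (G i))"
      unfolding topspace_product_topology by (rule PiE_cong) (rule topspace_factor)
    then show ?thesis
      unfolding set_eq_iff mem_carrier_limit_iff by fastforce
  qed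
  finally show ?thesis .
qed

lemma profinite_group_limit: "profinite_group lim_group lim_top"
proof -
  interpret P: profinite_group "product_group I G" "product_topology T I"
    using profinite by (rule profinite_group_product_group)
  show ?thesis
    using P.profinite_group_subgroup[OF subgroup_limit closedin_limit, folded limit_eq]
    by (simp add: inverse_limit_topology_def)
qed

section \<open>Projections and conjugacy in the limit\<close>

lemma group_hom_projection: "i \<in> I \<Longrightarrow> group_hom lim_group (G i) (\<lambda>x. x i)"
  unfolding group_hom_def group_hom_axioms_def
  by (intro conjI group_limit group_factor homI limit_component) (simp_all add: mult_limit)

lemma closed_normal_closure_component:
  assumes "x \<in> carrier lim_group" "y \<in> carrier lim_group" "i \<in> I"
    and "closed_normal_closure lim_group lim_top x = closed_normal_closure lim_group lim_top y"
  shows "closed_normal_closure (G i) (T i) (x i) = closed_normal_closure (G i) (T i) (y i)"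
proof (rule group_hom.closed_normal_closure_image_eq[OF group_hom_projection])
  show "topological_group lim_group lim_top"
    using profinite_group_limit by (simp add: profinite_group_def)
  show "continuous_map lim_top (T i) (\<lambda>x. x i)"
    unfolding inverse_limit_topology_def
    by (intro continuous_map_from_subtopology continuous_map_product_projection) fact
qed (use assms topological_group_factor in auto)

text \<open>Homomorphisms preserve conjugacy, and the transition map sends the coordinates of
  compatible families at \<open>i\<close> to those at \<open>j\<close>.\<close>

lemma conjugate_in_transition:
  assumes "x \<in> carrier lim_group" "z \<in> carrier lim_group" "(j, i) \<in> r" "conjugate_in (G i) (x i) (z i)"
  shows "conjugate_in (G j) (x j) (z j)"
proof -
  have "conjugate_in (G j) (\<phi> i j (x i)) (\<phi> i j (z i))"
    using group_hom.conjugate_in_image[OF group_hom_transition[OF assms(3)] assms(4)]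
      limit_component[OF assms(1)] index_mem[OF assms(3)] by simp
  then show ?thesis
    by (simp add: transition_limit assms)
qed

text \<open>The local-to-global step. The conjugators chosen at different indices need not be
  compatible; compactness of the sets of all conjugators provides a compatible choice.\<close>

lemma conjugate_in_limit:
  assumes x: "x \<in> carrier lim_group" and z: "z \<in> carrier lim_group"
    and conj: "\<And>i. i \<in> I \<Longrightarrow> conjugate_in (G i) (x i) (z i)"
  shows "conjugate_in lim_group x z"
proof -
  define C where "C i = {g \<in> carrier (G i). z i = g \<otimes>\<^bsub>G i\<^esub> x i \<otimes>\<^bsub>G i\<^esub> inv\<^bsub>G i\<^esub> g}" for i
  have "\<exists>g\<in>(\<Pi>\<^sub>E i\<in>I. C i). \<forall>(j, i)\<in>r. \<phi> i j (g i) = g j"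
  proof (rule compatible_family_exists[OF preorder directed])
    show "closedin (T i) (C i)" if "i \<in> I" for i
      unfolding C_def
      by (intro topological_group.closedin_conjugators topological_group_factor
          profinite_group.Hausdorff[OF profinite] limit_component x z that)
    show "C i \<noteq> {}" if "i \<in> I" for i
      using conj[OF that] by (auto simp: C_def conjugate_in_def)
    \<comment> \<open>The image of a conjugator conjugates the images, and by compatibility of
      \<open>x\<close> and \<open>z\<close> these are \<open>x j\<close> and
      \<open>z j\<close>.\<close>
    show "\<phi> i j ` C i \<subseteq> C j" if ji: "(j, i) \<in> r" for i j
    proof
      fix h assume "h \<in> \<phi> i j ` C i"
      then obtain g where g: "h = \<phi> i j g" "g \<in> carrier (G i)"
        "z i = g \<otimes>\<^bsub>G i\<^esub> x i \<otimes>\<^bsub>G i\<^esub> inv\<^bsub>G i\<^esub> g" by (auto simp: C_def)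
      interpret group_hom "G i" "G j" "\<phi> i j"
        using ji by (rule group_hom_transition)
      have "x i \<in> carrier (G i)"
        using x index_mem[OF ji] limit_component by blast
      then have "\<phi> i j (z i) = h \<otimes>\<^bsub>G j\<^esub> \<phi> i j (x i) \<otimes>\<^bsub>G j\<^esub> inv\<^bsub>G j\<^esub> h"
        using g by simp
      then show "h \<in> C j"
        using g(1,2) transition_limit[OF x ji] transition_limit[OF z ji] by (simp add: C_def)
    qed
    show "\<phi> j k (\<phi> i j a) = \<phi> i k a" if "(k, j) \<in> r" "(j, i) \<in> r" "a \<in> topspace (T i)" for i j k a
      using transition_comp[OF that(1,2)] that index_mem topspace_factor by blast
    show "\<phi> i i a = a" if "i \<in> I" "a \<in> topspace (T i)" for i a
      using transition_id that topspace_factor by blast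
  qed (assumption | rule transition_continuous profinite[THEN profinite_group.compact]
         profinite[THEN profinite_group.Hausdorff])+
  then obtain g where g: "g \<in> (\<Pi>\<^sub>E i\<in>I. C i)" "\<forall>(j, i)\<in>r. \<phi> i j (g i) = g j"
    by blast
  then have gL: "g \<in> carrier lim_group"
    by (auto simp: mem_carrier_limit_iff C_def PiE_iff)
  \<comment> \<open>Both sides are extensional, so equality is checked coordinatewise, where it is
    membership of \<open>g i\<close> in \<open>C i\<close>.\<close>
  have "z = g \<otimes>\<^bsub>lim_group\<^esub> x \<otimes>\<^bsub>lim_group\<^esub> inv\<^bsub>lim_group\<^esub> g"
  proof (rule extensionalityI[of _ I])
    show "z \<in> extensional I"
      using z by (simp add: mem_carrier_limit_iff PiE_def)
    show "g \<otimes>\<^bsub>lim_group\<^esub> x \<otimes>\<^bsub>lim_group\<^esub> inv\<^bsub>lim_group\<^esub> g \<in> extensional I"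
      by (simp add: mult_limit)
    show "z i = (g \<otimes>\<^bsub>lim_group\<^esub> x \<otimes>\<^bsub>lim_group\<^esub> inv\<^bsub>lim_group\<^esub> g) i" if "i \<in> I" for i
      using PiE_mem[OF g(1) that] that by (simp add: mult_limit inv_limit[OF gL] C_def)
  qed
  then show ?thesis
    using gL by (auto simp: conjugate_in_def)
qed

section \<open>The Magnus properties of the limit\<close>

lemma strong_magnus_property_limit:
  assumes "\<And>i. i \<in> I \<Longrightarrow> strong_magnus_property (G i) (T i)"
  shows "strong_magnus_property lim_group lim_top"
  unfolding strong_magnus_property_def
proof (intro conjI profinite_group_limit ballI impI)
  fix x y assume xy: "x \<in> carrier lim_group" "y \<in> carrier lim_group"
    and eq: "closed_normal_closure lim_group lim_top x = closed_normal_closure lim_group lim_top y"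
  show "conjugate_in lim_group x y"
    using xy
  proof (rule conjugate_in_limit)
    fix i assume "i \<in> I"
    then show "conjugate_in (G i) (x i) (y i)"
      using assms closed_normal_closure_component[OF xy _ eq] limit_component xy
      unfolding strong_magnus_property_def by blast
  qed
qed

lemma magnus_property_limit:
  assumes "\<And>i. i \<in> I \<Longrightarrow> magnus_property (G i) (T i)"
  shows "magnus_property lim_group lim_top"
  unfolding magnus_property_def
proof (intro conjI profinite_group_limit ballI impI)
  fix x y assume xy: "x \<in> carrier lim_group" "y \<in> carrier lim_group"
    and eq: "closed_normal_closure lim_group lim_top x = closed_normal_closure lim_group lim_top y"
  \<comment> \<open>The inverse of \<open>y\<close> is again a compatible family, so descent and the
    passage to the limit apply to \<open>z\<close> just as to \<open>y\<close>.\<close>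
  define z where "z = inv\<^bsub>lim_group\<^esub> y"
  have z: "z \<in> carrier lim_group"
    using xy group_limit by (simp add: z_def)
  have zi: "z i = inv\<^bsub>G i\<^esub> y i" if "i \<in> I" for i
    using that by (simp add: z_def inv_limit[OF xy(2)])
  have or: "conjugate_in (G i) (x i) (y i) \<or> conjugate_in (G i) (x i) (z i)" if i: "i \<in> I" for i
    using assms[OF i] closed_normal_closure_component[OF xy i eq] limit_component[OF _ i] xy
    unfolding magnus_property_def zi[OF i] by blast
  show "conjugate_in lim_group x y \<or> conjugate_in lim_group x (inv\<^bsub>lim_group\<^esub> y)"
  proof (cases "\<forall>i\<in>I. conjugate_in (G i) (x i) (y i)")
    case True
    then show ?thesis
      using conjugate_in_limit[OF xy] by blast
  next
    case False
    then obtain i where i: "i \<in> I" "\<not> conjugate_in (G i) (x i) (y i)" by blast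
    have "conjugate_in (G j) (x j) (z j)" if j: "j \<in> I" for j
    proof -
      obtain k where k: "k \<in> I" "(i, k) \<in> r" "(j, k) \<in> r"
        using directed[OF i(1) j] by blast
      \<comment> \<open>Were \<open>x k\<close> conjugate to \<open>y k\<close>, this would descend
        to \<open>i\<close>, contrary to the choice of \<open>i\<close>. So the other alternative
        holds at \<open>k\<close>, and it then descends to \<open>j\<close>.\<close>
      then have "conjugate_in (G k) (x k) (z k)"
        using or conjugate_in_transition[OF xy] i(2) by blast
      then show ?thesis
        using conjugate_in_transition[OF xy(1) z k(3)] by blast
    qed
    then show ?thesis
      using conjugate_in_limit[OF xy(1) z] by (simp add: z_def)
  qed
qed

end

theorem theorem1p5:
  fixes I :: "'i set" and r :: "'i rel"
    and G :: "'i \<Rightarrow> ('a, 'b) monoid_scheme" and T :: "'i \<Rightarrow> 'a topology"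
    and \<phi> :: "'i \<Rightarrow> 'i \<Rightarrow> 'a \<Rightarrow> 'a"
  assumes "profinite_inverse_system I r G T \<phi>"
  shows "((\<forall>i\<in>I. magnus_property (G i) (T i)) \<longrightarrow>
           magnus_property (inverse_limit_group I r G \<phi>) (inverse_limit_topology I r G T \<phi>)) \<and>
         ((\<forall>i\<in>I. strong_magnus_property (G i) (T i)) \<longrightarrow>
           strong_magnus_property (inverse_limit_group I r G \<phi>) (inverse_limit_topology I r G T \<phi>))"
proof -
  interpret profinite_inverse_system I r G T \<phi> by fact
  show ?thesis
    using magnus_property_limit strong_magnus_property_limit by blast
qed

end
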